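(* Let $C\subset\mathbb{R}^n$ be a pointed, $n$-dimensional closed convex cone, $\Omega=S^{n-1}\cap\operatorname{int}C^{\circ}$, and $\omega\subset\Omega$ a nonempty compact set. Then there exist $K,L\in\mathcal{K}(C,\omega)$ such that $S_{\gamma^{n}}(K,\cdot)=S_{\gamma^{n}}(L,\cdot)$ but $K\neq L$.
   Context: $C^{\circ}=\{x:\langle x,y\rangle\le 0\ \forall y\in C\}$. A pseudo-cone is a nonempty closed convex set $K$ with $o\notin K$ and $\lambda K\subseteq K$ for $\lambda\ge1$; it is a $C$-pseudo-cone if its recession cone $\{z:K+z\subseteq K\}$ equals $C$. Support function $h_K(x)=\sup_{y\in K}\langle x,y\rangle$ on $C^{\circ}$. For $u\in\Omega$, $H_K^-(u)=\{x:\langle x,u\rangle\le h_K(u)\}$. $\mathcal{K}(C,\omega)$ is the set of $C$-pseudo-cones $K$ with $K=C\cap\bigcap_{u\in\omega}H^-_K(u)$. For Borel $\eta\subset\Omega$, $S_{\gamma^n}(K,\eta)=(2\pi)^{-n/2}\int_{\nu_K^{-1}(\eta)}e^{-|x|^2/2}d\mathcal{H}^{n-1}(x)$, where $\nu_K^{-1}(\eta)$ is the set of boundary points of $K$ with an outer unit normal in $\eta$. *)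

theory Defs
  imports "HOL-Analysis.Analysis"
begin

section \<open>Hausdorff measure (normalised as usual)\<close>

definition hausdorff_const :: "real \<Rightarrow> real" where
  "hausdorff_const s = pi powr (s / 2) / Gamma (s / 2 + 1) / 2 powr s"

text \<open>The size-delta approximating outer measure: covers by countably many bounded sets
  of diameter at most delta.\<close>
definition hausdorff_pre :: "real \<Rightarrow> real \<Rightarrow> 'a::euclidean_space set \<Rightarrow> ennreal" where
  "hausdorff_pre s \<delta> A =
     (INF E \<in> {E :: nat \<Rightarrow> 'a set. A \<subseteq> (\<Union>i. E i) \<and> (\<forall>i. bounded (E i) \<and> diameter (E i) \<le> \<delta>)}.
        (\<Sum>i. ennreal (hausdorff_const s * diameter (E i) powr s)))"

definition hausdorff_outer :: "real \<Rightarrow> 'a::euclidean_space set \<Rightarrow> ennreal" where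
  "hausdorff_outer s A = (SUP \<delta> \<in> {0<..}. hausdorff_pre s \<delta> A)"

text \<open>s-dimensional Hausdorff measure, restricted to the Borel sets.\<close>
definition hausdorff_measure :: "real \<Rightarrow> 'a::euclidean_space measure" where
  "hausdorff_measure s = measure_of UNIV (sets borel) (hausdorff_outer s)"

section \<open>Cones and pseudo-cones\<close>

definition polar_cone :: "'a::euclidean_space set \<Rightarrow> 'a set" where
  "polar_cone C = {x. \<forall>y\<in>C. x \<bullet> y \<le> 0}"

definition pointed_cone :: "'a::euclidean_space set \<Rightarrow> bool" where
  "pointed_cone C \<longleftrightarrow> C \<inter> uminus ` C = {0}"

definition pseudo_cone :: "'a::euclidean_space set \<Rightarrow> bool" where
  "pseudo_cone K \<longleftrightarrow> K \<noteq> {} \<and> closed K \<and> convex K \<and> 0 \<notin> K \<and>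
     (\<forall>t::real. t \<ge> 1 \<longrightarrow> (\<lambda>y. t *\<^sub>R y) ` K \<subseteq> K)"

definition recession_cone :: "'a::euclidean_space set \<Rightarrow> 'a set" where
  "recession_cone K = {z. (\<lambda>y. y + z) ` K \<subseteq> K}"

definition C_pseudo_cone :: "'a::euclidean_space set \<Rightarrow> 'a set \<Rightarrow> bool" where
  "C_pseudo_cone C K \<longleftrightarrow> pseudo_cone K \<and> recession_cone K = C"

definition support_fun :: "'a::euclidean_space set \<Rightarrow> 'a \<Rightarrow> real" where
  "support_fun K x = Sup ((\<lambda>y. x \<bullet> y) ` K)"

definition half_space_K :: "'a::euclidean_space set \<Rightarrow> 'a \<Rightarrow> 'a set" where
  "half_space_K K u = {x. x \<bullet> u \<le> support_fun K u}"

text \<open>\<Omega> = S^{n-1} \<inter> int C\<degree>\<close>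
definition Omega :: "'a::euclidean_space set \<Rightarrow> 'a set" where
  "Omega C = sphere 0 1 \<inter> interior (polar_cone C)"

text \<open>\<K>(C,\<omega>)\<close>
definition KCw :: "'a::euclidean_space set \<Rightarrow> 'a set \<Rightarrow> 'a set set" where
  "KCw C \<omega> = {K. C_pseudo_cone C K \<and> K = C \<inter> (\<Inter>u\<in>\<omega>. half_space_K K u)}"

section \<open>Gaussian surface area measure\<close>

definition outer_unit_normal :: "'a::euclidean_space set \<Rightarrow> 'a \<Rightarrow> 'a \<Rightarrow> bool" where
  "outer_unit_normal K x u \<longleftrightarrow> norm u = 1 \<and> (\<forall>y\<in>K. (y - x) \<bullet> u \<le> 0)"

text \<open>reverse spherical image \<nu>_K^{-1}(\<eta>)\<close>
definition rev_gauss_image :: "'a::euclidean_space set \<Rightarrow> 'a set \<Rightarrow> 'a set" where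
  "rev_gauss_image K \<eta> = {x \<in> frontier K. \<exists>u\<in>\<eta>. outer_unit_normal K x u}"

definition gauss_surface_measure :: "'a::euclidean_space set \<Rightarrow> 'a set \<Rightarrow> ennreal" where
  "gauss_surface_measure K \<eta> =
     ennreal ((2 * pi) powr (- (real DIM('a) / 2))) *
     (\<integral>\<^sup>+ x. indicator (rev_gauss_image K \<eta>) x * ennreal (exp (- (norm x)\<^sup>2 / 2))
        \<partial>(hausdorff_measure (real DIM('a) - 1)))"

end

theory Submission
  imports Defs
begin

text \<open>Fix a direction u in \<omega> and cut C by the hyperplanes x \<bullet> u = -t. For t > 0 the cap
  K_t = C \<inter> {x \<bullet> u \<le> -t} belongs to \<K>(C,\<omega>), and its only boundary points with an outer
  normal in \<Omega> lie on the slice F_t = C \<inter> {x \<bullet> u = -t}. At slice points interior to C that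
  normal is u itself, while the slice points on the boundary of C form an H^(n-1)-null set. Hence
  the Gaussian surface area measure of K_t is the point mass at u with weight (2 pi)^(-n/2) f(t),
  where f(t) = \<integral> over F_t of exp(-|x|^2/2) = t^(n-1) \<integral> over F_1 of exp(-t^2|y|^2/2).
  Since n \<ge> 2, the function f is continuous and nonnegative on [0,\<infinity>), vanishes at 0 and
  tends to 0 at infinity, so it takes the same value at two different t.\<close>

section \<open>Hausdorff measure\<close>

lemma hausdorff_const_nonneg: "0 \<le> s \<Longrightarrow> 0 \<le> hausdorff_const s"
  unfolding hausdorff_const_def
  by (intro divide_nonneg_nonneg) (auto intro: less_imp_le Gamma_real_pos)

lemma hausdorff_pre_le_cover:
  assumes "A \<subseteq> (\<Union>i. E i)" "\<And>i. bounded (E i)" "\<And>i. diameter (E i) \<le> d"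
  shows "hausdorff_pre s d A \<le> (\<Sum>i. ennreal (hausdorff_const s * diameter (E i) powr s))"
  unfolding hausdorff_pre_def by (rule INF_lower) (use assms in auto)

lemma hausdorff_pre_le_finite_cover:
  fixes A :: "'a::euclidean_space set"
  assumes "finite F" "A \<subseteq> \<Union>F" "\<And>E. E \<in> F \<Longrightarrow> bounded E \<and> diameter E \<le> d" "0 \<le> d"
  shows "hausdorff_pre s d A \<le> (\<Sum>E\<in>F. ennreal (hausdorff_const s * diameter E powr s))"
proof -
  obtain xs where xs: "set xs = F" "distinct xs" using finite_distinct_list[OF assms(1)] by blast
  define E where "E i = (if i < length xs then xs ! i else {})" for i
  let ?g = "\<lambda>E. ennreal (hausdorff_const s * diameter E powr s)"
  have "A \<subseteq> (\<Union>i. E i)"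
    using assms(2) xs(1) by (force simp: E_def in_set_conv_nth)
  then have "hausdorff_pre s d A \<le> (\<Sum>i. ?g (E i))"
    using assms(3,4) xs(1) by (intro hausdorff_pre_le_cover) (auto simp: E_def)
  also have "(\<Sum>i. ?g (E i)) = (\<Sum>i<length xs. ?g (xs ! i))"
    by (subst suminf_finite[of "{..<length xs}"]) (auto simp: E_def)
  also have "\<dots> = (\<Sum>E\<in>F. ?g E)"
    using sum.distinct_set_conv_list[OF xs(2), of ?g] xs(1) by (simp add: sum_list_sum_nth atLeast0LessThan)
  finally show ?thesis .
qed

lemma hausdorff_pre_le_outer: "0 < d \<Longrightarrow> hausdorff_pre s d A \<le> hausdorff_outer s A"
  unfolding hausdorff_outer_def by (rule SUP_upper) auto

lemma hausdorff_outer_leI: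
  "(\<And>d. 0 < d \<Longrightarrow> hausdorff_pre s d A \<le> B) \<Longrightarrow> hausdorff_outer s A \<le> B"
  unfolding hausdorff_outer_def by (rule SUP_least) auto

lemma hausdorff_outer_mono: "A \<subseteq> B \<Longrightarrow> hausdorff_outer s A \<le> hausdorff_outer s B"
  unfolding hausdorff_outer_def hausdorff_pre_def
  by (intro SUP_subset_mono order_refl INF_superset_mono) auto

lemma ennreal_le_mult_INF:
  fixes g :: "'b \<Rightarrow> ennreal"
  assumes c: "0 < c" and le: "\<And>x. x \<in> X \<Longrightarrow> a \<le> ennreal c * g x"
  shows "a \<le> ennreal c * (INF x\<in>X. g x)"
proof -
  have cancel: "ennreal (1/c) * (ennreal c * y) = y" for y :: ennreal
    using c by (simp add: ennreal_mult'[symmetric] mult.assoc[symmetric])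
  have "ennreal (1/c) * a \<le> (INF x\<in>X. g x)"
  proof (rule INF_greatest)
    fix x assume "x \<in> X"
    then have "ennreal (1/c) * a \<le> ennreal (1/c) * (ennreal c * g x)"
      using le by (intro mult_left_mono) auto
    then show "ennreal (1/c) * a \<le> g x" by (simp only: cancel)
  qed
  then have "ennreal c * (ennreal (1/c) * a) \<le> ennreal c * (INF x\<in>X. g x)"
    by (intro mult_left_mono) auto
  then show ?thesis
    using c by (simp add: ennreal_mult'[symmetric] mult.assoc[symmetric])
qed

lemma lipschitz_image_diameter_le:
  fixes f :: "'a::real_normed_vector \<Rightarrow> 'b::real_normed_vector"
  assumes "bounded S" "0 \<le> c" "\<And>x y. dist (f x) (f y) \<le> c * dist x y"
  shows "bounded (f ` S)" "diameter (f ` S) \<le> c * diameter S"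
proof -
  have far: "dist (f x) (f y) \<le> c * diameter S" if "x \<in> S" "y \<in> S" for x y
    using assms that diameter_bounded_bound[OF assms(1)] by (meson mult_left_mono order_trans)
  show "bounded (f ` S)"
  proof (cases "S = {}")
    case False
    then obtain x0 where "x0 \<in> S" by auto
    then show ?thesis unfolding bounded_def using far by blast
  qed simp
  show "diameter (f ` S) \<le> c * diameter S"
  proof (rule diameter_le)
    show "f ` S \<noteq> {} \<or> 0 \<le> c * diameter S"
      using diameter_ge_0[OF assms(1)] assms(2) by simp
  qed (use far in \<open>auto simp: dist_norm\<close>)
qed

lemma hausdorff_outer_lipschitz_image_le:
  fixes f :: "'a::euclidean_space \<Rightarrow> 'b::euclidean_space"
  assumes c: "0 < c" and s: "0 \<le> s" and lip: "\<And>x y. dist (f x) (f y) \<le> c * dist x y"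
  shows "hausdorff_outer s (f ` A) \<le> ennreal (c powr s) * hausdorff_outer s A"
proof (rule hausdorff_outer_leI)
  fix d :: real assume d: "0 < d"
  let ?g = "\<lambda>E. ennreal (hausdorff_const s * diameter E powr s)"
  have "hausdorff_pre s d (f ` A) \<le> ennreal (c powr s) * hausdorff_pre s (d / c) A"
    unfolding hausdorff_pre_def[of s "d / c" A]
  proof (rule ennreal_le_mult_INF)
    fix E :: "nat \<Rightarrow> 'a set"
    assume "E \<in> {E. A \<subseteq> (\<Union>i. E i) \<and> (\<forall>i. bounded (E i) \<and> diameter (E i) \<le> d / c)}"
    then have E: "A \<subseteq> (\<Union>i. E i)" "\<And>i. bounded (E i)" "\<And>i. diameter (E i) \<le> d / c" by auto
    note fE = lipschitz_image_diameter_le[OF E(2) less_imp_le[OF c] lip]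
    have "hausdorff_pre s d (f ` A) \<le> (\<Sum>i. ?g (f ` E i))"
    proof (rule hausdorff_pre_le_cover)
      show "f ` A \<subseteq> (\<Union>i. f ` E i)" using E(1) by blast
      show "diameter (f ` E i) \<le> d" for i
        using fE(2)[of i] E(3)[of i] c by (simp add: field_simps)
    qed (use fE in auto)
    also have "\<dots> \<le> (\<Sum>i. ennreal (c powr s) * ?g (E i))"
    proof (intro suminf_le)
      fix i
      have "hausdorff_const s * diameter (f ` E i) powr s \<le> hausdorff_const s * (c * diameter (E i)) powr s"
        by (intro mult_left_mono powr_mono2 hausdorff_const_nonneg s fE diameter_ge_0)
      also have "\<dots> = c powr s * (hausdorff_const s * diameter (E i) powr s)"
        using c diameter_ge_0[OF E(2)[of i]] by (simp add: powr_mult)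
      finally show "?g (f ` E i) \<le> ennreal (c powr s) * ?g (E i)"
        using c by (simp add: ennreal_mult'[symmetric] ennreal_leI)
    qed auto
    also have "\<dots> = ennreal (c powr s) * (\<Sum>i. ?g (E i))"
      by (rule ennreal_suminf_cmult)
    finally show "hausdorff_pre s d (f ` A) \<le> ennreal (c powr s) * (\<Sum>i. ?g (E i))" .
  qed (use c in simp)
  also have "\<dots> \<le> ennreal (c powr s) * hausdorff_outer s A"
    using d c by (intro mult_left_mono hausdorff_pre_le_outer) auto
  finally show "hausdorff_pre s d (f ` A) \<le> ennreal (c powr s) * hausdorff_outer s A" .
qed

lemma hausdorff_outer_scaleR:
  fixes A :: "'a::euclidean_space set"
  assumes t: "0 < t" and s: "0 \<le> s"
  shows "hausdorff_outer s ((*\<^sub>R) t ` A) = ennreal (t powr s) * hausdorff_outer s A"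
proof (rule antisym)
  show "hausdorff_outer s ((*\<^sub>R) t ` A) \<le> ennreal (t powr s) * hausdorff_outer s A"
    using t s by (intro hausdorff_outer_lipschitz_image_le) (auto simp: dist_norm scaleR_diff_right[symmetric])
  have "(*\<^sub>R) (1/t) ` (*\<^sub>R) t ` A = A" using t by (auto simp: image_iff)
  then have "hausdorff_outer s A \<le> ennreal ((1/t) powr s) * hausdorff_outer s ((*\<^sub>R) t ` A)"
    using hausdorff_outer_lipschitz_image_le[of "1/t" s "(*\<^sub>R) (1/t)" "(*\<^sub>R) t ` A"] t s
    by (simp add: dist_norm scaleR_diff_right[symmetric])
  then have "ennreal (t powr s) * hausdorff_outer s A
      \<le> ennreal (t powr s) * (ennreal ((1/t) powr s) * hausdorff_outer s ((*\<^sub>R) t ` A))"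
    by (rule mult_left_mono) simp
  also have "\<dots> = hausdorff_outer s ((*\<^sub>R) t ` A)"
    using t by (simp add: mult.assoc[symmetric] ennreal_mult'[symmetric] powr_divide)
  finally show "ennreal (t powr s) * hausdorff_outer s A \<le> hausdorff_outer s ((*\<^sub>R) t ` A)" .
qed

definition face_grid_cell :: "'a::euclidean_space \<Rightarrow> real \<Rightarrow> real \<Rightarrow> real \<Rightarrow> ('a \<Rightarrow> nat) \<Rightarrow> 'a set" where
  "face_grid_cell i \<sigma> L h k =
     cbox (\<Sum>j\<in>Basis. (if j = i then \<sigma> else - L + real (k j) * h) *\<^sub>R j)
          (\<Sum>j\<in>Basis. (if j = i then \<sigma> else - L + (real (k j) + 1) * h) *\<^sub>R j)"

lemma mem_face_grid_cell:
  assumes "i \<in> Basis"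
  shows "x \<in> face_grid_cell i \<sigma> L h k \<longleftrightarrow> x \<bullet> i = \<sigma> \<and>
    (\<forall>j\<in>Basis - {i}. - L + real (k j) * h \<le> x \<bullet> j \<and> x \<bullet> j \<le> - L + (real (k j) + 1) * h)"
  using assms unfolding face_grid_cell_def mem_box(2) by (auto simp: inner_sum_left_Basis)

lemma diameter_face_grid_cell:
  assumes "i \<in> Basis" "0 \<le> h"
  shows "diameter (face_grid_cell (i::'a::euclidean_space) \<sigma> L h k) \<le> real (DIM('a) - 1) * h"
proof -
  define lo :: 'a where "lo = (\<Sum>j\<in>Basis. (if j = i then \<sigma> else - L + real (k j) * h) *\<^sub>R j)"
  define hi :: 'a where "hi = (\<Sum>j\<in>Basis. (if j = i then \<sigma> else - L + (real (k j) + 1) * h) *\<^sub>R j)"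
  have diff: "(hi - lo) \<bullet> j = (if j = i then 0 else h)" if "j \<in> Basis" for j
    using that unfolding lo_def hi_def by (simp add: inner_diff_left inner_sum_left_Basis algebra_simps)
  have "lo \<bullet> j \<le> hi \<bullet> j" if "j \<in> Basis" for j
    using diff[OF that] assms(2) by (simp add: inner_diff_left split: if_splits)
  then have "diameter (face_grid_cell i \<sigma> L h k) = norm (hi - lo)"
    unfolding face_grid_cell_def lo_def[symmetric] hi_def[symmetric]
    by (subst diameter_cbox) (auto simp: dist_norm norm_minus_commute)
  also have "\<dots> \<le> (\<Sum>j\<in>Basis. \<bar>(hi - lo) \<bullet> j\<bar>)" by (rule norm_le_l1)
  also have "\<dots> = (\<Sum>j\<in>Basis - {i}. h)"
    using assms by (simp add: diff sum.remove[of Basis i])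
  also have "\<dots> = real (DIM('a) - 1) * h" using assms(1) by (simp add: card_Diff_singleton)
  finally show ?thesis .
qed

lemma cube_face_subset_grid_cells:
  fixes i :: "'a::euclidean_space"
  assumes i: "i \<in> Basis" and h: "0 < h" "real N * h = 2 * L" and N: "1 \<le> N"
  shows "cbox (- L *\<^sub>R One) (L *\<^sub>R One) \<inter> {x. x \<bullet> i = \<sigma>}
    \<subseteq> (\<Union>k\<in>PiE (Basis - {i}) (\<lambda>_. {..<N}). face_grid_cell i \<sigma> L h k)"
proof
  fix x assume x: "x \<in> cbox (- L *\<^sub>R One) (L *\<^sub>R One) \<inter> {x. x \<bullet> i = \<sigma>}"
  define k where "k = restrict (\<lambda>j. min (N - 1) (nat \<lfloor>(x \<bullet> j + L) / h\<rfloor>)) (Basis - {i})"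
  have "- L + real (k j) * h \<le> x \<bullet> j \<and> x \<bullet> j \<le> - L + (real (k j) + 1) * h"
    if j: "j \<in> Basis - {i}" for j
  proof -
    define r where "r = (x \<bullet> j + L) / h"
    have "\<bar>x \<bullet> j\<bar> \<le> L" using x j by (auto simp: mem_box)
    then have r: "0 \<le> r" "r \<le> real N" using h unfolding r_def by (auto simp: field_simps)
    have "k j = min (N - 1) (nat \<lfloor>r\<rfloor>)" unfolding k_def r_def using j by auto
    then have "real (k j) \<le> r \<and> r \<le> real (k j) + 1"
      using r N by (cases "nat \<lfloor>r\<rfloor> \<le> N - 1") (auto simp: of_nat_diff, linarith+)
    then show ?thesis using h unfolding r_def by (auto simp: field_simps)
  qed
  then have "x \<in> face_grid_cell i \<sigma> L h k" using x i by (simp add: mem_face_grid_cell)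
  moreover have "k \<in> PiE (Basis - {i}) (\<lambda>_. {..<N})" unfolding k_def using N by auto
  ultimately show "x \<in> (\<Union>k\<in>PiE (Basis - {i}) (\<lambda>_. {..<N}). face_grid_cell i \<sigma> L h k)" by blast
qed

lemma hausdorff_pre_cube_face_le:
  fixes i :: "'a::euclidean_space"
  assumes i: "i \<in> Basis" and L: "0 < L" and d: "0 < d"
  defines "m \<equiv> DIM('a) - 1"
  shows "hausdorff_pre (real m) d (cbox (- L *\<^sub>R One) (L *\<^sub>R One) \<inter> {x. x \<bullet> i = \<sigma>})
          \<le> ennreal (hausdorff_const (real m) * (real m * (2 * L)) ^ m)"
proof -
  define N :: nat where "N = nat \<lceil>real m * 2 * L / d\<rceil> + 1"
  have N: "1 \<le> N" unfolding N_def by simp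
  define h where "h = 2 * L / real N"
  have h: "0 < h" "real N * h = 2 * L" using L N unfolding h_def by auto
  have mh: "real m * h \<le> d"
  proof -
    have "real m * 2 * L / d \<le> real N" unfolding N_def by linarith
    then show ?thesis using N d unfolding h_def by (simp add: field_simps)
  qed
  define P where "P = PiE (Basis - {i}) (\<lambda>_. {..<N})"
  have finite_P: "finite P" unfolding P_def by (intro finite_PiE) auto
  let ?cell = "face_grid_cell i \<sigma> L h"
  let ?g = "\<lambda>E. ennreal (hausdorff_const (real m) * diameter E powr real m)"
  have cell_diameter: "diameter (?cell k) \<le> real m * h" for k
    unfolding m_def using i h by (intro diameter_face_grid_cell) auto
  have "bounded (?cell k) \<and> diameter (?cell k) \<le> d" for k
    using order_trans[OF cell_diameter mh] unfolding face_grid_cell_def by simp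
  then have "hausdorff_pre (real m) d (cbox (- L *\<^sub>R One) (L *\<^sub>R One) \<inter> {x. x \<bullet> i = \<sigma>})
      \<le> (\<Sum>E\<in>?cell ` P. ?g E)"
    using cube_face_subset_grid_cells[OF i h N] d finite_P unfolding P_def
    by (intro hausdorff_pre_le_finite_cover) auto
  also have "\<dots> \<le> (\<Sum>E\<in>?cell ` P. ennreal (hausdorff_const (real m) * (real m * h) ^ m))"
  proof (intro sum_mono ennreal_leI mult_left_mono hausdorff_const_nonneg)
    fix E assume "E \<in> ?cell ` P"
    then obtain k where "E = ?cell k" by blast
    then have E: "0 \<le> diameter E" "diameter E \<le> real m * h"
      using cell_diameter[of k] diameter_ge_0[of E] by (auto simp: face_grid_cell_def)
    show "diameter E powr real m \<le> (real m * h) ^ m"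
    proof (cases "m = 0")
      case False
      then have "diameter E powr real m \<le> (real m * h) powr real m"
        using E by (intro powr_mono2) auto
      also have "\<dots> = (real m * h) ^ m" using False h by (simp add: powr_realpow)
      finally show ?thesis .
    qed (simp add: powr_def)
  qed simp
  also have "\<dots> \<le> of_nat (card P) * ennreal (hausdorff_const (real m) * (real m * h) ^ m)"
    unfolding sum_constant by (intro mult_right_mono of_nat_mono card_image_le finite_P) simp
  also have "\<dots> = ennreal (hausdorff_const (real m) * (real m * (2 * L)) ^ m)"
  proof -
    have "card P = N ^ m" unfolding P_def m_def using i by (simp add: card_PiE card_Diff_singleton)
    moreover have "(real m * (2 * L)) ^ m = real N ^ m * (real m * h) ^ m"
      unfolding h(2)[symmetric] by (simp add: power_mult_distrib)
    ultimately show ?thesis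
      using hausdorff_const_nonneg[of "real m"] h
      by (simp add: ennreal_of_nat_eq_real_of_nat ennreal_mult''[symmetric] mult_ac)
  qed
  finally show ?thesis .
qed

lemma ray_meets_frontier:
  fixes p v :: "'a::real_normed_vector"
  assumes "bounded Q" "p \<in> Q" "v \<noteq> 0"
  obtains r where "0 \<le> r" "p + r *\<^sub>R v \<in> frontier Q"
proof -
  obtain B where B: "\<And>x. x \<in> Q \<Longrightarrow> norm x \<le> B" using assms(1) unfolding bounded_iff by blast
  define s where "s = (\<bar>B\<bar> + norm p + 1) / norm v"
  have s: "0 \<le> s" "norm (s *\<^sub>R v) = \<bar>B\<bar> + norm p + 1" using assms(3) unfolding s_def by auto
  have "p + s *\<^sub>R v \<notin> Q"
  proof
    assume "p + s *\<^sub>R v \<in> Q"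
    then have "norm (p + s *\<^sub>R v) \<le> B" by (rule B)
    moreover have "norm (s *\<^sub>R v) \<le> norm (p + s *\<^sub>R v) + norm p"
      using norm_triangle_ineq4[of "p + s *\<^sub>R v" p] by simp
    ultimately show False using s(2) by linarith
  qed
  then have "closed_segment p (p + s *\<^sub>R v) \<inter> frontier Q \<noteq> {}"
    using assms(2) by (intro connected_Int_frontier) auto
  then obtain q where q: "q \<in> closed_segment p (p + s *\<^sub>R v)" "q \<in> frontier Q" by blast
  then obtain u where u: "0 \<le> u" "q = (1 - u) *\<^sub>R p + u *\<^sub>R (p + s *\<^sub>R v)"
    unfolding in_segment by auto
  then have "p + (u * s) *\<^sub>R v \<in> frontier Q" using q(2) by (simp add: algebra_simps)
  moreover have "0 \<le> u * s" using u(1) s(1) by simp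
  ultimately show ?thesis by (rule that[rotated])
qed

text \<open>From a boundary point p of D go against the normal of a supporting hyperplane at p until
  leaving Q; the nearest point of D to the exit point is p.\<close>
lemma frontier_convex_subset_closest_point_image:
  fixes D :: "'a::euclidean_space set"
  assumes D: "convex D" "closed D" "aff_dim D = DIM('a)" and Q: "D \<subseteq> Q" "bounded Q"
  shows "frontier D \<subseteq> closest_point D ` frontier Q"
proof
  fix p assume p: "p \<in> frontier D"
  have pD: "p \<in> D" using p D(2) frontier_subset_closed by blast
  have "p \<notin> rel_interior D"
    using p D(3) interior_rel_interior_gen[of D] unfolding frontier_def by auto
  moreover have "p \<in> closure D" using pD closure_subset by blast
  ultimately obtain a where a: "a \<noteq> 0" "\<And>y. y \<in> closure D \<Longrightarrow> a \<bullet> p \<le> a \<bullet> y"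
    using supporting_hyperplane_relative_frontier[OF D(1)] by blast
  obtain r where r: "0 \<le> r" "p + r *\<^sub>R (- a) \<in> frontier Q"
    using ray_meets_frontier[OF Q(2) subsetD[OF Q(1) pD], of "- a"] a(1) by auto
  define q where "q = p + r *\<^sub>R (- a)"
  have "p = closest_point D q"
  proof (rule closest_point_unique[OF D(1,2) pD], intro ballI)
    fix z assume "z \<in> D"
    then have "a \<bullet> p \<le> a \<bullet> z" by (intro a(2) subsetD[OF closure_subset])
    moreover have "(q - p) \<bullet> (p - z) = r * (a \<bullet> z - a \<bullet> p)"
      unfolding q_def by (simp add: inner_diff_right algebra_simps)
    ultimately have "0 \<le> (q - p) \<bullet> (p - z)"
      using r(1) by simp
    moreover have "2 * ((q - p) \<bullet> (p - z)) = (norm (q - z))\<^sup>2 - (norm (q - p))\<^sup>2 - (norm (p - z))\<^sup>2"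
      using dot_norm[of "q - p" "p - z"] by simp
    ultimately have "(norm (q - p))\<^sup>2 \<le> (norm (q - z))\<^sup>2"
      using zero_le_power2[of "norm (p - z)"] by linarith
    then show "dist q p \<le> dist q z"
      using power2_le_imp_le[OF _ norm_ge_zero] by (simp add: dist_norm)
  qed
  then show "p \<in> closest_point D ` frontier Q" using r(2) unfolding q_def by blast
qed

lemma sets_hausdorff_measure [simp, measurable_cong]:
  "sets (hausdorff_measure s :: 'a::euclidean_space measure) = sets borel"
  unfolding hausdorff_measure_def
  by (subst sets_measure_of) (auto simp: sets.sigma_sets_eq[of borel, simplified])

lemma space_hausdorff_measure [simp]:
  "space (hausdorff_measure s :: 'a::euclidean_space measure) = UNIV"
  unfolding hausdorff_measure_def by (simp add: space_measure_of_conv)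

lemma emeasure_hausdorff_measure:
  assumes "measure_space (UNIV::'a::euclidean_space set) (sets borel) (hausdorff_outer s)"
    and "A \<in> sets borel"
  shows "emeasure (hausdorff_measure s :: 'a measure) A = hausdorff_outer s A"
  unfolding hausdorff_measure_def emeasure_measure_of_conv
  using assms by (simp add: sets.sigma_sets_eq[of borel, simplified])

lemma emeasure_hausdorff_measure_degenerate:
  assumes "\<not> measure_space (UNIV::'a::euclidean_space set) (sets borel) (hausdorff_outer s)"
  shows "emeasure (hausdorff_measure s :: 'a measure) A = 0"
  unfolding hausdorff_measure_def emeasure_measure_of_conv
  using assms by (simp add: sets.sigma_sets_eq[of borel, simplified])

lemma emeasure_frontier_cube_finite:
  assumes additive: "measure_space (UNIV::'a::euclidean_space set) (sets borel) (hausdorff_outer (real DIM('a) - 1))"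
    and L: "0 < L"
  shows "emeasure (hausdorff_measure (real DIM('a) - 1)) (frontier (cbox (- L *\<^sub>R One) (L *\<^sub>R One) :: 'a set)) < \<infinity>"
proof -
  let ?s = "real DIM('a) - 1"
  let ?\<mu> = "hausdorff_measure ?s :: 'a measure"
  define face where "face i \<sigma> = cbox (- L *\<^sub>R One) (L *\<^sub>R One) \<inter> {x::'a. x \<bullet> i = \<sigma>}" for i \<sigma>
  define X where "X = ennreal (hausdorff_const ?s * (?s * (2 * L)) ^ (DIM('a) - 1))"
  have face_borel: "face i \<sigma> \<in> sets borel" for i \<sigma>
    unfolding face_def by (intro borel_closed closed_Int closed_cbox closed_Collect_eq continuous_intros)
  have face_le: "emeasure ?\<mu> (face i \<sigma>) \<le> X" if "i \<in> Basis" for i \<sigma>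
  proof -
    have s: "?s = real (DIM('a) - 1)" by (simp add: of_nat_diff)
    have "emeasure ?\<mu> (face i \<sigma>) = hausdorff_outer ?s (face i \<sigma>)"
      by (rule emeasure_hausdorff_measure[OF additive face_borel])
    also have "\<dots> \<le> X"
      unfolding X_def face_def s by (intro hausdorff_outer_leI hausdorff_pre_cube_face_le that L)
    finally show ?thesis .
  qed
  have "frontier (cbox (- L *\<^sub>R One) (L *\<^sub>R One)) \<subseteq> (\<Union>i\<in>Basis. face i L \<union> face i (- L))"
    unfolding frontier_cbox face_def by (force simp: mem_box)
  then have "emeasure ?\<mu> (frontier (cbox (- L *\<^sub>R One) (L *\<^sub>R One)))
      \<le> emeasure ?\<mu> (\<Union>i\<in>Basis. face i L \<union> face i (- L))"
    using face_borel by (intro emeasure_mono) auto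
  also have "\<dots> \<le> (\<Sum>i\<in>Basis. emeasure ?\<mu> (face i L \<union> face i (- L)))"
    using face_borel by (intro emeasure_subadditive_finite) auto
  also have "\<dots> \<le> (\<Sum>i\<in>(Basis::'a set). X + X)"
    using face_borel face_le by (intro sum_mono order_trans[OF emeasure_subadditive] add_mono) auto
  also have "\<dots> < \<infinity>" unfolding X_def by (simp add: ennreal_mult_less_top of_nat_less_top)
  finally show ?thesis .
qed

lemma emeasure_frontier_convex_body_finite:
  fixes D :: "'a::euclidean_space set"
  assumes additive: "measure_space (UNIV::'a set) (sets borel) (hausdorff_outer (real DIM('a) - 1))"
    and D: "convex D" "compact D" "aff_dim D = DIM('a)"
  shows "emeasure (hausdorff_measure (real DIM('a) - 1) :: 'a measure) (frontier D) < \<infinity>"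
proof -
  let ?s = "real DIM('a) - 1"
  let ?\<mu> = "hausdorff_measure ?s :: 'a measure"
  obtain B where B: "\<And>x. x \<in> D \<Longrightarrow> norm x \<le> B"
    using compact_imp_bounded[OF D(2)] unfolding bounded_iff by blast
  define L where "L = \<bar>B\<bar> + 1"
  have L: "0 < L" unfolding L_def by simp
  define Q :: "'a set" where "Q = cbox (- L *\<^sub>R One) (L *\<^sub>R One)"
  have DQ: "D \<subseteq> Q"
  proof
    fix x assume "x \<in> D"
    then have "\<bar>x \<bullet> i\<bar> \<le> L" if "i \<in> Basis" for i
      using B Basis_le_norm[OF that, of x] unfolding L_def by fastforce
    then show "x \<in> Q" unfolding Q_def by (force simp: mem_box abs_le_iff)
  qed
  have "emeasure ?\<mu> (frontier D) = hausdorff_outer ?s (frontier D)"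
    by (rule emeasure_hausdorff_measure[OF additive borel_closed[OF frontier_closed]])
  also have "\<dots> \<le> hausdorff_outer ?s (closest_point D ` frontier Q)"
    using D DQ compact_imp_closed unfolding Q_def
    by (intro hausdorff_outer_mono frontier_convex_subset_closest_point_image) auto
  also have "\<dots> \<le> hausdorff_outer ?s (frontier Q)"
    using hausdorff_outer_lipschitz_image_le[of 1 ?s "closest_point D" "frontier Q"]
      closest_point_lipschitz[OF D(1) compact_imp_closed[OF D(2)]] D(3)
    by fastforce
  also have "\<dots> = emeasure ?\<mu> (frontier Q)"
    by (rule emeasure_hausdorff_measure[OF additive borel_closed[OF frontier_closed], symmetric])
  also have "\<dots> < \<infinity>"
    unfolding Q_def by (rule emeasure_frontier_cube_finite[OF additive L])
  finally show ?thesis .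
qed

lemma nn_integral_hausdorff_measure_scaleR:
  fixes g :: "'a::euclidean_space \<Rightarrow> ennreal"
  assumes additive: "measure_space (UNIV::'a set) (sets borel) (hausdorff_outer s)"
    and s: "0 \<le> s" and t: "0 < t" and g[measurable]: "g \<in> borel_measurable borel"
  shows "(\<integral>\<^sup>+x. g x \<partial>hausdorff_measure s) = ennreal (t powr s) * (\<integral>\<^sup>+y. g (t *\<^sub>R y) \<partial>hausdorff_measure s)"
proof -
  let ?\<mu> = "hausdorff_measure s :: 'a measure"
  let ?c = "ennreal ((1/t) powr s)"
  have scale_measurable: "(*\<^sub>R) t \<in> measurable ?\<mu> borel" by measurable
  have "distr ?\<mu> borel ((*\<^sub>R) t) = density ?\<mu> (\<lambda>_. ?c)"
  proof (rule measure_eqI)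
    fix A assume "A \<in> sets (distr ?\<mu> borel ((*\<^sub>R) t))"
    then have A: "A \<in> sets borel" by simp
    have preimage: "(*\<^sub>R) t -` A \<inter> space ?\<mu> = (*\<^sub>R) (1/t) ` A"
      using t by (force simp: image_iff)
    have "(*\<^sub>R) (1/t) ` A \<in> sets borel"
      using measurable_sets[OF scale_measurable A] unfolding preimage by simp
    then have "emeasure (distr ?\<mu> borel ((*\<^sub>R) t)) A = hausdorff_outer s ((*\<^sub>R) (1/t) ` A)"
      using emeasure_distr[OF scale_measurable A] preimage emeasure_hausdorff_measure[OF additive]
      by simp
    also have "\<dots> = ?c * emeasure ?\<mu> A"
      using hausdorff_outer_scaleR[of "1/t" s A] t s emeasure_hausdorff_measure[OF additive A] by simp
    also have "\<dots> = emeasure (density ?\<mu> (\<lambda>_. ?c)) A"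
      using A by (simp add: emeasure_density_const)
    finally show "emeasure (distr ?\<mu> borel ((*\<^sub>R) t)) A = emeasure (density ?\<mu> (\<lambda>_. ?c)) A" .
  qed simp
  then have "(\<integral>\<^sup>+y. g (t *\<^sub>R y) \<partial>?\<mu>) = (\<integral>\<^sup>+x. ?c * g x \<partial>?\<mu>)"
    using nn_integral_distr[OF scale_measurable, of g] by (simp add: nn_integral_density)
  also have "\<dots> = ?c * (\<integral>\<^sup>+x. g x \<partial>?\<mu>)" by (rule nn_integral_cmult) simp
  finally have "ennreal (t powr s) * (\<integral>\<^sup>+y. g (t *\<^sub>R y) \<partial>?\<mu>) = ennreal (t powr s) * ?c * (\<integral>\<^sup>+x. g x \<partial>?\<mu>)"
    by (simp add: mult.assoc)
  also have "ennreal (t powr s) * ?c = 1"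
    using t by (simp add: ennreal_mult'[symmetric] powr_divide)
  finally show ?thesis by simp
qed

text \<open>The measure hausdorff_measure is built with measure_of, which gives the null measure unless
  the Hausdorff outer measure is countably additive on the Borel sets; in that case every Gaussian
  surface area measure vanishes.\<close>
lemma gauss_surface_measure_degenerate:
  assumes "\<not> measure_space (UNIV::'a::euclidean_space set) (sets borel) (hausdorff_outer (real DIM('a) - 1))"
  shows "gauss_surface_measure (K::'a set) \<eta> = 0"
proof -
  let ?\<mu> = "hausdorff_measure (real DIM('a) - 1) :: 'a measure"
  have "AE x in ?\<mu>. False"
    using emeasure_hausdorff_measure_degenerate[OF assms, of UNIV]
    by (intro AE_I'[of UNIV]) (auto simp: null_sets_def)
  then have "AE x in ?\<mu>. indicator (rev_gauss_image K \<eta>) x * ennreal (exp (- (norm x)\<^sup>2 / 2)) = 0"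
    by (rule eventually_mono) simp
  then have "(\<integral>\<^sup>+x. indicator (rev_gauss_image K \<eta>) x * ennreal (exp (- (norm x)\<^sup>2 / 2)) \<partial>?\<mu>)
      = (\<integral>\<^sup>+x. 0 \<partial>?\<mu>)"
    by (rule nn_integral_cong_AE)
  then show ?thesis unfolding gauss_surface_measure_def by simp
qed

lemma ennreal_eq_0_if_multiples_bounded:
  fixes a B :: ennreal
  assumes "B < \<infinity>" and "\<And>N. of_nat N * a \<le> B"
  shows "a = 0"
proof -
  have "\<infinity> * a = (SUP N. of_nat N * a)"
    by (simp add: ennreal_SUP_of_nat_eq_top[symmetric] SUP_mult_right_ennreal)
  also have "\<dots> \<le> B" by (intro SUP_least assms(2))
  finally show ?thesis using assms(1) by (auto simp: ennreal_top_mult split: if_splits)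
qed

section \<open>Slicing a cone\<close>

lemma polar_cone_interior_inner_le:
  fixes C :: "'a::euclidean_space set"
  assumes "u \<in> interior (polar_cone C)"
  shows "\<exists>e>0. \<forall>x\<in>C. x \<bullet> u \<le> - e * norm x"
proof -
  obtain r where r: "0 < r" "ball u r \<subseteq> polar_cone C"
    using assms by (auto simp: mem_interior)
  have "x \<bullet> u \<le> - (r / 2) * norm x" if x: "x \<in> C" for x
  proof (cases "x = 0")
    case False
    let ?w = "u + (r / 2 / norm x) *\<^sub>R x"
    have "dist u ?w < r" using False r by (simp add: dist_norm)
    then have "?w \<bullet> x \<le> 0" using r x unfolding polar_cone_def by auto
    moreover have "?w \<bullet> x = u \<bullet> x + (r / 2) * norm x"
      using False by (simp add: inner_add_left power2_norm_eq_inner[symmetric] power2_eq_square)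
    ultimately show ?thesis by (simp add: inner_commute)
  qed simp
  then show ?thesis using r(1) by (intro exI[of _ "r / 2"]) auto
qed

lemma cone_scaleR_interior:
  fixes C :: "'a::euclidean_space set"
  assumes "cone C" "0 < c"
  shows "(*\<^sub>R) c ` interior C = interior C"
proof (cases "C = {}")
  case False
  then have "(*\<^sub>R) c ` C = C" using assms cone_iff[of C] by auto
  then show ?thesis
    using interior_injective_linear_image[of "(*\<^sub>R) c" C] assms(2) by (simp add: linear_scaleR inj_on_def)
qed simp

definition cone_cap :: "'a::euclidean_space set \<Rightarrow> 'a \<Rightarrow> real \<Rightarrow> 'a set" where
  "cone_cap C u t = {x \<in> C. x \<bullet> u \<le> - t}"

definition cone_slice :: "'a::euclidean_space set \<Rightarrow> 'a \<Rightarrow> real \<Rightarrow> 'a set" where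
  "cone_slice C u t = {x \<in> C. x \<bullet> u = - t}"

definition cone_slab :: "'a::euclidean_space set \<Rightarrow> 'a \<Rightarrow> real \<Rightarrow> real \<Rightarrow> 'a set" where
  "cone_slab C u a b = {x \<in> C. - b \<le> x \<bullet> u \<and> x \<bullet> u \<le> - a}"

locale cone_slicing =
  fixes C :: "'a::euclidean_space set" and u :: 'a
  assumes closed: "closed C" and convex: "convex C" and cone: "cone C"
    and full_dim: "aff_dim C = DIM('a)" and direction: "u \<in> Omega C"
begin

lemma norm_u: "norm u = 1"
  using direction unfolding Omega_def by auto

lemma inner_u_le_norm: "\<exists>e>0. \<forall>x\<in>C. x \<bullet> u \<le> - e * norm x"
  using direction polar_cone_interior_inner_le unfolding Omega_def by blast

lemma inner_u_neg:
  assumes "x \<in> C" "x \<noteq> 0"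
  shows "x \<bullet> u < 0"
proof -
  obtain e where "0 < e" "\<forall>x\<in>C. x \<bullet> u \<le> - e * norm x" using inner_u_le_norm by blast
  moreover have "0 < e * norm x" using \<open>0 < e\<close> assms(2) by simp
  ultimately show ?thesis using assms(1) by force
qed

lemma inner_u_nonpos: "x \<in> C \<Longrightarrow> x \<bullet> u \<le> 0"
  using inner_u_neg by (cases "x = 0") (auto intro: less_imp_le)

lemma scaleR_mem: "x \<in> C \<Longrightarrow> 0 \<le> c \<Longrightarrow> c *\<^sub>R x \<in> C"
  using cone unfolding cone_def by blast

lemma add_mem: "x \<in> C \<Longrightarrow> y \<in> C \<Longrightarrow> x + y \<in> C"
  using convex_cone[of C] convex cone by blast

lemma nonempty: "C \<noteq> {}"
  using full_dim by auto

lemma zero_mem: "0 \<in> C"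
  using nonempty scaleR_mem[of _ 0] by auto

lemma cone_slice_nonempty:
  assumes "0 < t"
  obtains p where "p \<in> cone_slice C u t"
proof -
  have "C \<noteq> {0}" using full_dim by auto
  then obtain x where x: "x \<in> C" "x \<noteq> 0" using zero_mem by blast
  define c where "c = t / - (x \<bullet> u)"
  have "x \<bullet> u < 0" using x by (rule inner_u_neg)
  then have "0 \<le> c" "c * (x \<bullet> u) = - t" using assms unfolding c_def by (auto simp: divide_pos_neg less_imp_le)
  then have "c *\<^sub>R x \<in> cone_slice C u t" using x scaleR_mem unfolding cone_slice_def by auto
  then show ?thesis by (rule that)
qed

lemma bounded_above_level: "bounded {x \<in> C. - t \<le> x \<bullet> u}"
proof -
  obtain e where e: "0 < e" "\<forall>x\<in>C. x \<bullet> u \<le> - e * norm x" using inner_u_le_norm by blast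
  have "norm x \<le> t / e" if "x \<in> C" "- t \<le> x \<bullet> u" for x
    using e that by (force simp: field_simps)
  then show ?thesis unfolding bounded_iff by blast
qed

lemma closed_cone_cap: "closed (cone_cap C u t)"
proof -
  have "cone_cap C u t = C \<inter> {x. x \<bullet> u \<le> - t}" unfolding cone_cap_def by blast
  then show ?thesis by (simp add: closed_Int closed closed_Collect_le continuous_intros)
qed

lemma pseudo_cone_cone_cap:
  assumes t: "0 < t"
  shows "pseudo_cone (cone_cap C u t)"
proof -
  obtain p where "p \<in> cone_slice C u t" using cone_slice_nonempty[OF t] .
  then have "cone_cap C u t \<noteq> {}" unfolding cone_slice_def cone_cap_def by auto
  moreover have "convex (cone_cap C u t)"
  proof -
    have "cone_cap C u t = C \<inter> {x. u \<bullet> x \<le> - t}" unfolding cone_cap_def by (auto simp: inner_commute)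
    then show ?thesis by (simp add: convex_Int convex convex_halfspace_le)
  qed
  moreover have "0 \<notin> cone_cap C u t" using t unfolding cone_cap_def by auto
  moreover have "c *\<^sub>R x \<in> cone_cap C u t" if c: "1 \<le> c" and x: "x \<in> cone_cap C u t" for c x
  proof -
    have "(c - 1) * (x \<bullet> u) \<le> 0" using c x t unfolding cone_cap_def by (intro mult_nonneg_nonpos) auto
    then show ?thesis using c x scaleR_mem unfolding cone_cap_def by (auto simp: algebra_simps)
  qed
  ultimately show ?thesis unfolding pseudo_cone_def using closed_cone_cap by blast
qed

lemma recession_cone_cone_cap:
  assumes t: "0 < t"
  shows "recession_cone (cone_cap C u t) = C"
proof (intro equalityI subsetI)
  fix z assume "z \<in> C"
  then show "z \<in> recession_cone (cone_cap C u t)"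
    using add_mem inner_u_nonpos unfolding recession_cone_def cone_cap_def
    by (force simp: inner_add_left)
next
  fix z assume z: "z \<in> recession_cone (cone_cap C u t)"
  obtain p where "p \<in> cone_slice C u t" using cone_slice_nonempty[OF t] .
  then have p: "p \<in> cone_cap C u t" unfolding cone_slice_def cone_cap_def by auto
  have orbit: "p + real n *\<^sub>R z \<in> cone_cap C u t" for n
  proof (induction n)
    case (Suc n)
    then have "(p + real n *\<^sub>R z) + z \<in> cone_cap C u t"
      using z unfolding recession_cone_def by blast
    then show ?case by (simp add: algebra_simps)
  qed (simp add: p)
  \<comment> \<open>the points of the orbit, shrunk back into C, converge to z\<close>
  have "inverse (real (Suc n)) *\<^sub>R (p + real (Suc n) *\<^sub>R z) \<in> C" for n
    using orbit[of "Suc n"] scaleR_mem unfolding cone_cap_def by auto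
  then have "inverse (real (Suc n)) *\<^sub>R p + z \<in> C" for n
    by (simp add: scaleR_add_right)
  moreover have "(\<lambda>n. inverse (real (Suc n)) *\<^sub>R p + z) \<longlonglongrightarrow> 0 *\<^sub>R p + z"
    by (intro tendsto_intros LIMSEQ_inverse_real_of_nat)
  ultimately show "z \<in> C" using closed_sequentially[OF closed] by fastforce
qed

lemma cone_cap_eq_inter_half_spaces:
  assumes t: "0 < t" and \<omega>: "u \<in> \<omega>" "\<omega> \<subseteq> Omega C"
  shows "cone_cap C u t = C \<inter> (\<Inter>v\<in>\<omega>. half_space_K (cone_cap C u t) v)"
proof (intro equalityI subsetI)
  fix x assume x: "x \<in> cone_cap C u t"
  have "x \<bullet> v \<le> support_fun (cone_cap C u t) v" if "v \<in> \<omega>" for v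
  proof -
    have "v \<in> polar_cone C" using that \<omega>(2) interior_subset unfolding Omega_def by blast
    then have "bdd_above ((\<lambda>y. v \<bullet> y) ` cone_cap C u t)"
      unfolding polar_cone_def cone_cap_def by (auto intro: bdd_aboveI2)
    then show ?thesis unfolding support_fun_def using x by (auto simp: inner_commute intro: cSup_upper)
  qed
  then show "x \<in> C \<inter> (\<Inter>v\<in>\<omega>. half_space_K (cone_cap C u t) v)"
    using x unfolding half_space_K_def cone_cap_def by auto
next
  fix x assume x: "x \<in> C \<inter> (\<Inter>v\<in>\<omega>. half_space_K (cone_cap C u t) v)"
  obtain p where "p \<in> cone_slice C u t" using cone_slice_nonempty[OF t] .
  then have "cone_cap C u t \<noteq> {}" unfolding cone_slice_def cone_cap_def by auto
  then have "support_fun (cone_cap C u t) u \<le> - t"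
    unfolding support_fun_def by (intro cSup_least) (auto simp: cone_cap_def inner_commute)
  then show "x \<in> cone_cap C u t" using x \<omega>(1) unfolding half_space_K_def cone_cap_def by force
qed

lemma cone_cap_in_KCw:
  assumes "0 < t" "u \<in> \<omega>" "\<omega> \<subseteq> Omega C"
  shows "cone_cap C u t \<in> KCw C \<omega>"
  using assms pseudo_cone_cone_cap recession_cone_cone_cap cone_cap_eq_inter_half_spaces
  unfolding KCw_def C_pseudo_cone_def by blast

lemma cone_cap_strict_anti:
  assumes "0 < s" "s < t"
  shows "cone_cap C u s \<noteq> cone_cap C u t"
proof -
  obtain p where "p \<in> cone_slice C u s" using cone_slice_nonempty[OF assms(1)] .
  then have "p \<in> cone_cap C u s" "p \<notin> cone_cap C u t"
    using assms(2) unfolding cone_slice_def cone_cap_def by auto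
  then show ?thesis by blast
qed

lemma normal_cone_cap_off_slice:
  assumes x: "x \<in> cone_cap C u t" "x \<bullet> u < - t"
    and normal: "\<forall>y\<in>cone_cap C u t. (y - x) \<bullet> v \<le> 0" and y: "y \<in> C"
  shows "(y - x) \<bullet> v \<le> 0"
proof -
  define \<delta> where "\<delta> = - t - x \<bullet> u"
  define \<epsilon> where "\<epsilon> = min 1 (\<delta> / (1 + \<bar>(y - x) \<bullet> u\<bar>))"
  have \<delta>: "0 < \<delta>" using x(2) unfolding \<delta>_def by simp
  have \<epsilon>: "0 < \<epsilon>" "\<epsilon> \<le> 1" using \<delta> unfolding \<epsilon>_def by auto
  have "\<epsilon> * \<bar>(y - x) \<bullet> u\<bar> \<le> \<delta>"
  proof -
    have "\<epsilon> * \<bar>(y - x) \<bullet> u\<bar> \<le> \<delta> / (1 + \<bar>(y - x) \<bullet> u\<bar>) * (1 + \<bar>(y - x) \<bullet> u\<bar>)"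
      unfolding \<epsilon>_def using \<delta> by (intro mult_mono) auto
    then show ?thesis by simp
  qed
  moreover have "\<epsilon> * ((y - x) \<bullet> u) \<le> \<epsilon> * \<bar>(y - x) \<bullet> u\<bar>" using \<epsilon>(1) by simp
  ultimately have "(x + \<epsilon> *\<^sub>R (y - x)) \<bullet> u \<le> - t"
    unfolding \<delta>_def by (simp add: inner_add_left)
  moreover have "x + \<epsilon> *\<^sub>R (y - x) \<in> C"
    using convexD[OF convex, of x y "1 - \<epsilon>" \<epsilon>] x(1) y \<epsilon> unfolding cone_cap_def
    by (simp add: algebra_simps)
  ultimately have "(\<epsilon> *\<^sub>R (y - x)) \<bullet> v \<le> 0"
    using normal unfolding cone_cap_def by force
  then show ?thesis using \<epsilon>(1) by (simp add: mult_le_0_iff)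
qed

lemma rev_gauss_image_cone_cap_subset:
  assumes t: "0 < t" and \<eta>: "\<eta> \<subseteq> Omega C"
  shows "rev_gauss_image (cone_cap C u t) \<eta> \<subseteq> cone_slice C u t"
proof
  fix x assume "x \<in> rev_gauss_image (cone_cap C u t) \<eta>"
  then obtain v where x: "x \<in> cone_cap C u t" and v: "v \<in> Omega C"
    and normal: "\<forall>y\<in>cone_cap C u t. (y - x) \<bullet> v \<le> 0"
    using \<eta> frontier_subset_closed[OF closed_cone_cap]
    unfolding rev_gauss_image_def outer_unit_normal_def by blast
  show "x \<in> cone_slice C u t"
  proof (rule ccontr)
    assume "x \<notin> cone_slice C u t"
    then have off: "x \<bullet> u < - t" using x unfolding cone_slice_def cone_cap_def by auto
    have xC: "x \<in> C" using x unfolding cone_cap_def by auto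
    \<comment> \<open>v is normal to C at x, so x is orthogonal to v (test with 0 and 2x); but v is interior to the polar\<close>
    have "(0 - x) \<bullet> v \<le> 0" "(2 *\<^sub>R x - x) \<bullet> v \<le> 0"
      using normal_cone_cap_off_slice[OF x off normal zero_mem]
        normal_cone_cap_off_slice[OF x off normal scaleR_mem[OF xC, of 2]] by auto
    then have "x \<bullet> v = 0" by (simp add: scaleR_2)
    moreover obtain e where "0 < e" "\<forall>y\<in>C. y \<bullet> v \<le> - e * norm y"
      using v polar_cone_interior_inner_le unfolding Omega_def by blast
    ultimately have "x = 0" using xC by (force simp: mult_le_0_iff)
    then show False using off t by simp
  qed
qed

lemma slice_in_frontier_with_normal_u:
  assumes "x \<in> cone_slice C u t" and "cone_slice C u t \<subseteq> K" and "K \<subseteq> {y. y \<bullet> u \<le> - t}"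
  shows "x \<in> frontier K" "outer_unit_normal K x u"
proof -
  have uu: "u \<bullet> u = 1" using norm_u by (simp add: power2_norm_eq_inner[symmetric])
  have xu: "x \<bullet> u = - t" using assms(1) unfolding cone_slice_def by auto
  have "x \<notin> interior K"
  proof
    assume "x \<in> interior K"
    then obtain r where r: "0 < r" "ball x r \<subseteq> K" by (auto simp: mem_interior)
    then have "x + (r / 2) *\<^sub>R u \<in> K" using norm_u by (auto simp: dist_norm)
    then show False using assms(3) xu uu r(1) by (auto simp: inner_add_left)
  qed
  then show "x \<in> frontier K" using assms(1,2) closure_subset unfolding frontier_def by auto
  show "outer_unit_normal K x u"
    using assms(3) norm_u xu unfolding outer_unit_normal_def by (auto simp: inner_diff_left)
qed

lemma outer_unit_normal_cone_cap_interior: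
  assumes x: "x \<in> cone_slice C u t" "x \<in> interior C"
    and v: "outer_unit_normal (cone_cap C u t) x v"
  shows "v = u"
proof -
  have uu: "u \<bullet> u = 1" using norm_u by (simp add: power2_norm_eq_inner[symmetric])
  have vv: "v \<bullet> v = 1" using v unfolding outer_unit_normal_def by (simp add: power2_norm_eq_inner[symmetric])
  obtain r where r: "0 < r" "ball x r \<subseteq> C" using x(2) by (auto simp: mem_interior)
  \<comment> \<open>near x the cap is the half-space below the slice, whose only unit normal is u\<close>
  have below: "w \<bullet> v \<le> 0" if "norm w < r" "w \<bullet> u \<le> 0" for w
  proof -
    have "x + w \<in> cone_cap C u t"
      using that r x(1) unfolding cone_slice_def cone_cap_def by (auto simp: dist_norm inner_add_left)
    then show ?thesis using v unfolding outer_unit_normal_def by force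
  qed
  define w where "w = v - (v \<bullet> u) *\<^sub>R u"
  define k where "k = r / (2 * (1 + norm w))"
  have k: "0 < k" "norm (k *\<^sub>R w) < r"
  proof -
    show "0 < k" unfolding k_def using r by (simp add: add_pos_nonneg)
    have "norm (k *\<^sub>R w) \<le> k * (1 + norm w)" using \<open>0 < k\<close> by simp
    also have "\<dots> = r / 2"
      using add_pos_nonneg[OF zero_less_one norm_ge_zero[of w]] unfolding k_def by (simp add: field_simps)
    finally show "norm (k *\<^sub>R w) < r" using r by simp
  qed
  have wu: "w \<bullet> u = 0" unfolding w_def using uu by (simp add: inner_diff_left)
  have "(k *\<^sub>R w) \<bullet> v \<le> 0" "(- (k *\<^sub>R w)) \<bullet> v \<le> 0"
    using below[of "k *\<^sub>R w"] below[of "- (k *\<^sub>R w)"] k wu by auto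
  then have "w \<bullet> v = 0" using k(1) by (simp add: mult_le_0_iff zero_le_mult_iff)
  then have "(v \<bullet> u)\<^sup>2 = 1"
    using vv unfolding w_def by (simp add: inner_diff_right inner_commute power2_eq_square)
  moreover have "(- (r / 2) *\<^sub>R u) \<bullet> v \<le> 0" using r norm_u uu by (intro below) auto
  then have "0 \<le> v \<bullet> u" using r by (simp add: inner_commute zero_le_mult_iff)
  ultimately have "v \<bullet> u = 1" by (auto simp: power2_eq_1_iff)
  then have "(v - u) \<bullet> (v - u) = 0" using vv uu by (simp add: inner_diff_left inner_diff_right inner_commute)
  then show "v = u" by simp
qed

lemma rev_gauss_image_cone_cap_interior_iff:
  assumes "x \<in> cone_slice C u t" "x \<in> interior C"
  shows "x \<in> rev_gauss_image (cone_cap C u t) \<eta> \<longleftrightarrow> u \<in> \<eta>"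
proof -
  have "x \<in> frontier (cone_cap C u t)" "outer_unit_normal (cone_cap C u t) x u"
    by (intro slice_in_frontier_with_normal_u[OF assms(1)]; force simp: cone_slice_def cone_cap_def)+
  then show ?thesis
    using outer_unit_normal_cone_cap_interior[OF assms] unfolding rev_gauss_image_def by auto
qed

lemma closed_cone_slice: "closed (cone_slice C u t)"
proof -
  have "cone_slice C u t = C \<inter> {x. x \<bullet> u = - t}" unfolding cone_slice_def by blast
  then show ?thesis by (simp add: closed_Int closed closed_Collect_eq continuous_intros)
qed

lemma cone_slab_convex_body:
  assumes "0 \<le> a" "a < b"
  shows "convex (cone_slab C u a b)" "compact (cone_slab C u a b)"
    "aff_dim (cone_slab C u a b) = DIM('a)"
proof -
  have slab: "cone_slab C u a b = C \<inter> {x. - b \<le> x \<bullet> u \<and> x \<bullet> u \<le> - a}"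
    unfolding cone_slab_def by blast
  have "cone_slab C u a b = C \<inter> {x. u \<bullet> x \<ge> - b} \<inter> {x. u \<bullet> x \<le> - a}"
    unfolding cone_slab_def by (auto simp: inner_commute)
  then show "convex (cone_slab C u a b)"
    by (simp add: convex_Int convex convex_halfspace_ge convex_halfspace_le)
  have "closed (cone_slab C u a b)"
    unfolding slab by (intro closed_Int closed closed_Collect_conj closed_Collect_le continuous_intros)
  moreover have "bounded (cone_slab C u a b)"
    using bounded_above_level[of b] by (rule bounded_subset) (auto simp: cone_slab_def)
  ultimately show "compact (cone_slab C u a b)" by (simp add: compact_eq_bounded_closed)
  have "0 < (a + b) / 2" using assms by simp
  then obtain p where p: "p \<in> cone_slice C u ((a + b) / 2)" by (rule cone_slice_nonempty)
  have "{x. - b < x \<bullet> u \<and> x \<bullet> u < - a} \<subseteq> interior {x. - b \<le> x \<bullet> u \<and> x \<bullet> u \<le> - a}"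
    by (intro interior_maximal open_Collect_conj open_Collect_less continuous_intros) auto
  moreover have "- b < p \<bullet> u" "p \<bullet> u < - a" using p assms(2) unfolding cone_slice_def by auto
  ultimately have "C \<inter> interior {x. - b \<le> x \<bullet> u \<and> x \<bullet> u \<le> - a} \<noteq> {}"
    using p unfolding cone_slice_def by blast
  then show "aff_dim (cone_slab C u a b) = DIM('a)"
    unfolding slab using aff_dim_convex_Int_nonempty_interior[OF convex] full_dim by simp
qed

lemma cone_slice_subset_frontier_slab:
  assumes "a \<le> b"
  shows "cone_slice C u a \<subseteq> frontier (cone_slab C u a b)"
  using slice_in_frontier_with_normal_u(1)[of _ a "cone_slab C u a b"] assms
  unfolding cone_slice_def cone_slab_def by force

lemma cone_slice_edge_subset_frontier_slab:
  assumes "a \<le> s" "s \<le> b"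
  shows "cone_slice C u s - interior C \<subseteq> frontier (cone_slab C u a b)"
proof
  fix x assume x: "x \<in> cone_slice C u s - interior C"
  then have "x \<in> cone_slab C u a b" using assms unfolding cone_slice_def cone_slab_def by auto
  moreover have "interior (cone_slab C u a b) \<subseteq> interior C"
    by (rule interior_mono) (auto simp: cone_slab_def)
  ultimately show "x \<in> frontier (cone_slab C u a b)"
    using x closure_subset unfolding frontier_def by auto
qed

lemma scaleR_cone_slice:
  assumes c: "0 < c"
  shows "(*\<^sub>R) c ` cone_slice C u t = cone_slice C u (c * t)"
proof
  show "(*\<^sub>R) c ` cone_slice C u t \<subseteq> cone_slice C u (c * t)"
    using c scaleR_mem unfolding cone_slice_def by auto
  show "cone_slice C u (c * t) \<subseteq> (*\<^sub>R) c ` cone_slice C u t"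
  proof
    fix y assume "y \<in> cone_slice C u (c * t)"
    then have "(1 / c) *\<^sub>R y \<in> cone_slice C u t"
      using c scaleR_mem unfolding cone_slice_def by auto
    moreover have "y = c *\<^sub>R ((1 / c) *\<^sub>R y)" using c by simp
    ultimately show "y \<in> (*\<^sub>R) c ` cone_slice C u t" by blast
  qed
qed

lemma scaleR_cone_slice_edge:
  assumes "0 < c"
  shows "(*\<^sub>R) c ` (cone_slice C u t - interior C) = cone_slice C u (c * t) - interior C"
  using assms scaleR_cone_slice cone_scaleR_interior[OF cone]
  by (simp add: image_set_diff inj_on_def)

lemma borel_cone_slice [measurable]: "cone_slice C u t \<in> sets borel"
  by (rule borel_closed[OF closed_cone_slice])

lemma scaleR_mem_cone_slice_iff: "0 < t \<Longrightarrow> t *\<^sub>R y \<in> cone_slice C u t \<longleftrightarrow> y \<in> cone_slice C u 1"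
  using scaleR_cone_slice[of t 1] inj_image_mem_iff[of "(*\<^sub>R) t" y "cone_slice C u 1"]
  by (simp add: inj_on_def)

lemma norm_ge_on_cone_slice: "y \<in> cone_slice C u t \<Longrightarrow> \<bar>t\<bar> \<le> norm y"
  using Cauchy_Schwarz_ineq2[of y u] norm_u unfolding cone_slice_def by auto
end

section \<open>The Gaussian mass of the slices\<close>

lemma not_injective_if_vanishing_at_0_and_at_top:
  fixes f :: "real \<Rightarrow> real"
  assumes cont: "\<And>b. continuous_on {0..b} f" and f0: "f 0 = 0"
    and nonneg: "\<And>t. 0 \<le> t \<Longrightarrow> 0 \<le> f t" and lim: "(f \<longlongrightarrow> 0) at_top"
  shows "\<exists>s t. 0 < s \<and> s < t \<and> f s = f t"
proof (cases "\<forall>t>0. f t = 0")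
  case True
  then show ?thesis by (intro exI[of _ 1] exI[of _ 2]) auto
next
  case False
  then obtain t0 where t0: "0 < t0" "f t0 \<noteq> 0" by auto
  define c where "c = f t0 / 2"
  have c: "0 < c" "c < f t0" using t0 nonneg[of t0] unfolding c_def by auto
  have "\<forall>\<^sub>F b in at_top. f b < c \<and> t0 < b"
    using order_tendstoD(2)[OF lim c(1)] eventually_gt_at_top[of t0] by (rule eventually_conj)
  then obtain b where b: "f b < c" "t0 < b" using eventually_happens by fastforce
  obtain s where s: "0 \<le> s" "s \<le> t0" "f s = c"
    using IVT'[of f 0 c t0] f0 c t0 cont by auto
  obtain t where t: "t0 \<le> t" "t \<le> b" "f t = c"
    using IVT2'[of f b c t0] b c t0 cont[of b] continuous_on_subset[of "{0..b}" f "{t0..b}"] by auto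
  have "s \<noteq> 0" "s \<noteq> t0" "t \<noteq> t0" using s t c f0 by auto
  then show ?thesis using s t by (intro exI[of _ s] exI[of _ t]) auto
qed

lemma tendsto_power_mult_exp_neg_square: "((\<lambda>t::real. t ^ m * exp (- t\<^sup>2 / 2)) \<longlongrightarrow> 0) at_top"
proof (rule tendsto_sandwich[of "\<lambda>_. 0" _ _ "\<lambda>t. t ^ m / exp t"])
  show "\<forall>\<^sub>F t::real in at_top. 0 \<le> t ^ m * exp (- t\<^sup>2 / 2)"
    using eventually_ge_at_top[of "0::real"] by eventually_elim simp
  show "\<forall>\<^sub>F t::real in at_top. t ^ m * exp (- t\<^sup>2 / 2) \<le> t ^ m / exp t"
    using eventually_ge_at_top[of "2::real"]
  proof eventually_elim
    fix t :: real assume t: "2 \<le> t"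
    then have "- t\<^sup>2 / 2 \<le> - t" by (simp add: power2_eq_square)
    then have "t ^ m * exp (- t\<^sup>2 / 2) \<le> t ^ m * exp (- t)" using t by (intro mult_left_mono) auto
    then show "t ^ m * exp (- t\<^sup>2 / 2) \<le> t ^ m / exp t" by (simp add: exp_minus field_simps)
  qed
qed (auto intro: tendsto_power_div_exp_0)

definition scaled_gauss :: "nat \<Rightarrow> real \<Rightarrow> 'a::real_normed_vector \<Rightarrow> real" where
  "scaled_gauss m t y = t ^ m * exp (- (t * norm y)\<^sup>2 / 2)"

lemma borel_measurable_scaled_gauss [measurable]: "scaled_gauss m t \<in> borel_measurable borel"
  unfolding scaled_gauss_def by measurable

lemma scaled_gauss_bounds:
  assumes "0 \<le> t" "t \<le> b"
  shows "0 \<le> scaled_gauss m t y" "\<bar>scaled_gauss m t y\<bar> \<le> b ^ m"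
proof -
  show "0 \<le> scaled_gauss m t y" using assms(1) unfolding scaled_gauss_def by simp
  have "scaled_gauss m t y \<le> t ^ m"
    using assms(1) mult_left_le[of "exp (- (t * norm y)\<^sup>2 / 2)" "t ^ m"] unfolding scaled_gauss_def by simp
  also have "\<dots> \<le> b ^ m" using assms by (intro power_mono)
  finally show "\<bar>scaled_gauss m t y\<bar> \<le> b ^ m"
    using assms(1) unfolding scaled_gauss_def by simp
qed

lemma scaled_gauss_le_tail:
  assumes "0 \<le> t" "1 \<le> norm y"
  shows "scaled_gauss m t y \<le> t ^ m * exp (- t\<^sup>2 / 2)"
proof -
  have "t\<^sup>2 * 1 \<le> t\<^sup>2 * (norm y)\<^sup>2" using assms(2) by (intro mult_left_mono) (auto simp: one_le_power)
  then show ?thesis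
    unfolding scaled_gauss_def using assms(1) by (intro mult_left_mono) (auto simp: power_mult_distrib)
qed

locale cone_slicing_hausdorff = cone_slicing C u for C :: "'a::euclidean_space set" and u +
  assumes additive: "measure_space (UNIV::'a set) (sets borel) (hausdorff_outer (real DIM('a) - 1))"
begin

abbreviation \<H> :: "'a measure" where
  "\<H> \<equiv> hausdorff_measure (real DIM('a) - 1)"

lemma emeasure_eq_hausdorff_outer: "A \<in> sets borel \<Longrightarrow> emeasure \<H> A = hausdorff_outer (real DIM('a) - 1) A"
  by (rule emeasure_hausdorff_measure[OF additive])

lemma emeasure_frontier_slab_finite:
  assumes "0 \<le> a" "a < b"
  shows "emeasure \<H> (frontier (cone_slab C u a b)) < \<infinity>"
  using emeasure_frontier_convex_body_finite[OF additive] cone_slab_convex_body[OF assms] by blast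

lemma emeasure_cone_slice_finite:
  assumes "0 < t"
  shows "emeasure \<H> (cone_slice C u t) < \<infinity>"
proof -
  have "emeasure \<H> (cone_slice C u t) \<le> emeasure \<H> (frontier (cone_slab C u t (2 * t)))"
    using assms by (intro emeasure_mono cone_slice_subset_frontier_slab) auto
  also have "\<dots> < \<infinity>" using assms by (intro emeasure_frontier_slab_finite) auto
  finally show ?thesis .
qed

text \<open>The edges of the slices at levels between t and 2t are disjoint, lie in the boundary of
  the slab between these levels, and by homogeneity are at least as large as the edge at level t.
  As the boundary of the slab has finite measure, that edge is null.\<close>
lemma emeasure_cone_slice_edge:
  assumes t: "0 < t"
  shows "emeasure \<H> (cone_slice C u t - interior C) = 0"
proof (rule ennreal_eq_0_if_multiples_bounded)
  let ?s = "real DIM('a) - 1"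
  let ?edge = "\<lambda>t. cone_slice C u t - interior C"
  have edge_borel: "?edge t \<in> sets borel" for t
    using closed_cone_slice by (intro sets.Diff borel_closed borel_open open_interior)
  show "emeasure \<H> (frontier (cone_slab C u t (2 * t))) < \<infinity>"
    using t by (intro emeasure_frontier_slab_finite) auto
  fix N :: nat
  show "of_nat N * emeasure \<H> (?edge t) \<le> emeasure \<H> (frontier (cone_slab C u t (2 * t)))"
  proof (cases "N = 0")
    case False
    define c where "c k = 1 + real k / real N" for k :: nat
    have c: "1 \<le> c k" "k < N \<Longrightarrow> c k \<le> 2" for k
      using False unfolding c_def by (auto simp: field_simps)
    have larger: "emeasure \<H> (?edge t) \<le> emeasure \<H> (?edge (c k * t))" for k
    proof -
      have "emeasure \<H> (?edge (c k * t)) = ennreal (c k powr ?s) * emeasure \<H> (?edge t)"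
        using c(1)[of k] scaleR_cone_slice_edge[of "c k" t] hausdorff_outer_scaleR[of "c k" ?s "?edge t"]
        by (simp add: emeasure_eq_hausdorff_outer edge_borel)
      moreover have "1 \<le> c k powr ?s" using c(1)[of k] by (simp add: ge_one_powr_ge_zero)
      then have "1 * emeasure \<H> (?edge t) \<le> ennreal (c k powr ?s) * emeasure \<H> (?edge t)"
        by (intro mult_right_mono) auto
      ultimately show ?thesis by simp
    qed
    have "c k * t \<noteq> c k' * t" if "k \<noteq> k'" for k k'
      using t False that unfolding c_def by (simp add: field_simps)
    then have disjoint: "disjoint_family_on (\<lambda>k. ?edge (c k * t)) {..<N}"
      unfolding disjoint_family_on_def cone_slice_def by fastforce
    have "of_nat N * emeasure \<H> (?edge t) = (\<Sum>k<N. emeasure \<H> (?edge t))" by simp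
    also have "\<dots> \<le> (\<Sum>k<N. emeasure \<H> (?edge (c k * t)))" by (intro sum_mono larger)
    also have "\<dots> = emeasure \<H> (\<Union>k<N. ?edge (c k * t))"
      using disjoint edge_borel by (intro sum_emeasure) auto
    also have "\<dots> \<le> emeasure \<H> (frontier (cone_slab C u t (2 * t)))"
      using c t by (intro emeasure_mono UN_least cone_slice_edge_subset_frontier_slab) auto
    finally show ?thesis .
  qed simp
qed

lemma nn_integral_rev_gauss_image_cone_cap:
  assumes t: "0 < t" and \<eta>: "\<eta> \<subseteq> Omega C"
  shows "(\<integral>\<^sup>+x. indicator (rev_gauss_image (cone_cap C u t) \<eta>) x * ennreal (exp (- (norm x)\<^sup>2 / 2)) \<partial>\<H>)
       = (if u \<in> \<eta> then (\<integral>\<^sup>+x. indicator (cone_slice C u t) x * ennreal (exp (- (norm x)\<^sup>2 / 2)) \<partial>\<H>) else 0)"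
proof -
  let ?G = "rev_gauss_image (cone_cap C u t) \<eta>"
  let ?F = "cone_slice C u t"
  have "AE x in \<H>. indicator ?G x = (if u \<in> \<eta> then indicator ?F x else (0::ennreal))"
  proof (rule AE_I')
    show "?F - interior C \<in> null_sets \<H>"
      using emeasure_cone_slice_edge[OF t] by (auto simp: null_sets_def)
    show "{x \<in> space \<H>. indicator ?G x \<noteq> (if u \<in> \<eta> then indicator ?F x else (0::ennreal))} \<subseteq> ?F - interior C"
      using rev_gauss_image_cone_cap_subset[OF t \<eta>] rev_gauss_image_cone_cap_interior_iff[of _ t \<eta>]
      by (auto split: split_indicator if_splits)
  qed
  then have "AE x in \<H>. indicator ?G x * ennreal (exp (- (norm x)\<^sup>2 / 2))
      = (if u \<in> \<eta> then indicator ?F x * ennreal (exp (- (norm x)\<^sup>2 / 2)) else 0)"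
    by eventually_elim simp
  then show ?thesis by (subst nn_integral_cong_AE) auto
qed

definition slice_gauss_mass :: "real \<Rightarrow> real" where
  "slice_gauss_mass t = (\<integral>y. indicator (cone_slice C u 1) y * scaled_gauss (DIM('a) - 1) t y \<partial>\<H>)"

lemma integrable_scaled_gauss_on_slice:
  assumes "0 \<le> b"
  shows "integrable \<H> (\<lambda>y. indicator (cone_slice C u 1) y * (b ^ (DIM('a) - 1)))"
    and "0 \<le> t \<Longrightarrow> t \<le> b \<Longrightarrow> integrable \<H> (\<lambda>y. indicator (cone_slice C u 1) y * scaled_gauss (DIM('a) - 1) t y)"
proof -
  show bound: "integrable \<H> (\<lambda>y. indicator (cone_slice C u 1) y * (b ^ (DIM('a) - 1)))"
    using emeasure_cone_slice_finite[of 1] by (intro integrable_mult_left integrable_real_indicator) auto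
  assume "0 \<le> t" "t \<le> b"
  then show "integrable \<H> (\<lambda>y. indicator (cone_slice C u 1) y * scaled_gauss (DIM('a) - 1) t y)"
    using scaled_gauss_bounds[of t b]
    by (intro Bochner_Integration.integrable_bound[OF bound])
      (auto split: split_indicator intro!: AE_I2)
qed

lemma nn_integral_gauss_cone_slice:
  assumes t: "0 < t"
  shows "(\<integral>\<^sup>+x. indicator (cone_slice C u t) x * ennreal (exp (- (norm x)\<^sup>2 / 2)) \<partial>\<H>)
       = ennreal (slice_gauss_mass t)"
proof -
  let ?m = "DIM('a) - 1"
  have "(\<integral>\<^sup>+x. indicator (cone_slice C u t) x * ennreal (exp (- (norm x)\<^sup>2 / 2)) \<partial>\<H>)
      = ennreal (t powr (real DIM('a) - 1))
        * (\<integral>\<^sup>+y. indicator (cone_slice C u t) (t *\<^sub>R y) * ennreal (exp (- (norm (t *\<^sub>R y))\<^sup>2 / 2)) \<partial>\<H>)"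
    using t by (intro nn_integral_hausdorff_measure_scaleR[OF additive]) auto
  also have "\<dots> = (\<integral>\<^sup>+y. ennreal (indicator (cone_slice C u 1) y * scaled_gauss ?m t y) \<partial>\<H>)"
  proof (subst nn_integral_cmult[symmetric], measurable, intro nn_integral_cong)
    fix y :: 'a
    have "real DIM('a) - 1 = real ?m" by (simp add: of_nat_diff)
    then have "t powr (real DIM('a) - 1) = t ^ ?m" using t by (simp only: powr_realpow)
    then show "ennreal (t powr (real DIM('a) - 1)) * (indicator (cone_slice C u t) (t *\<^sub>R y)
        * ennreal (exp (- (norm (t *\<^sub>R y))\<^sup>2 / 2)))
      = ennreal (indicator (cone_slice C u 1) y * scaled_gauss ?m t y)"
      using t scaleR_mem_cone_slice_iff[OF t, of y]
      by (simp add: scaled_gauss_def indicator_def ennreal_mult'[symmetric])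
  qed
  also have "\<dots> = ennreal (slice_gauss_mass t)"
    unfolding slice_gauss_mass_def using t scaled_gauss_bounds(1)[of t t]
    by (intro nn_integral_eq_integral integrable_scaled_gauss_on_slice(2)[of t])
      (auto intro!: AE_I2 mult_nonneg_nonneg)
  finally show ?thesis .
qed

lemma gauss_surface_measure_cone_cap:
  assumes "0 < t" "\<eta> \<subseteq> Omega C"
  shows "gauss_surface_measure (cone_cap C u t) \<eta> = ennreal ((2 * pi) powr (- (real DIM('a) / 2)))
      * (if u \<in> \<eta> then ennreal (slice_gauss_mass t) else 0)"
  unfolding gauss_surface_measure_def nn_integral_rev_gauss_image_cone_cap[OF assms]
    nn_integral_gauss_cone_slice[OF assms(1)] ..

lemma slice_gauss_mass_nonneg: "0 \<le> t \<Longrightarrow> 0 \<le> slice_gauss_mass t"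
  unfolding slice_gauss_mass_def using scaled_gauss_bounds(1)[of t t]
  by (intro integral_nonneg_AE AE_I2 mult_nonneg_nonneg) auto

lemma slice_gauss_mass_0:
  assumes "2 \<le> DIM('a)"
  shows "slice_gauss_mass 0 = 0"
proof -
  have "scaled_gauss (DIM('a) - 1) 0 y = 0" for y :: 'a
    using assms unfolding scaled_gauss_def by simp
  then show ?thesis unfolding slice_gauss_mass_def by simp
qed

lemma continuous_on_slice_gauss_mass: "continuous_on {0..b} slice_gauss_mass"
proof (rule continuous_on_sequentiallyI)
  fix x a assume x: "\<forall>n. x n \<in> {0..b}" and "a \<in> {0..b}" and lim: "x \<longlonglongrightarrow> a"
  show "(\<lambda>n. slice_gauss_mass (x n)) \<longlonglongrightarrow> slice_gauss_mass a"
    unfolding slice_gauss_mass_def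
  proof (rule integral_dominated_convergence)
    show "integrable \<H> (\<lambda>y. indicator (cone_slice C u 1) y * (b ^ (DIM('a) - 1)))"
      using x by (intro integrable_scaled_gauss_on_slice(1)) (meson atLeastAtMost_iff order_trans)
    show "AE y in \<H>. (\<lambda>n. indicator (cone_slice C u 1) y * scaled_gauss (DIM('a) - 1) (x n) y)
        \<longlonglongrightarrow> indicator (cone_slice C u 1) y * scaled_gauss (DIM('a) - 1) a y"
      unfolding scaled_gauss_def by (intro AE_I2 tendsto_intros lim) simp
    show "AE y in \<H>. norm (indicator (cone_slice C u 1) y * scaled_gauss (DIM('a) - 1) (x n) y)
        \<le> indicator (cone_slice C u 1) y * b ^ (DIM('a) - 1)" for n
      using x scaled_gauss_bounds[of "x n" b] by (intro AE_I2) (auto split: split_indicator)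
  qed (auto simp: scaled_gauss_def)
qed

lemma tendsto_slice_gauss_mass: "(slice_gauss_mass \<longlongrightarrow> 0) at_top"
proof (rule tendsto_sandwich)
  let ?M = "measure \<H> (cone_slice C u 1)"
  show "\<forall>\<^sub>F t in at_top. 0 \<le> slice_gauss_mass t"
    using eventually_ge_at_top[of 0] by eventually_elim (rule slice_gauss_mass_nonneg)
  show "\<forall>\<^sub>F t in at_top. slice_gauss_mass t \<le> t ^ (DIM('a) - 1) * exp (- t\<^sup>2 / 2) * ?M"
    using eventually_ge_at_top[of 0]
  proof eventually_elim
    fix t :: real assume t: "0 \<le> t"
    have "slice_gauss_mass t \<le> (\<integral>y. indicator (cone_slice C u 1) y * (t ^ (DIM('a) - 1) * exp (- t\<^sup>2 / 2)) \<partial>\<H>)"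
      unfolding slice_gauss_mass_def
      using t scaled_gauss_le_tail[of t] norm_ge_on_cone_slice[of _ 1]
        emeasure_cone_slice_finite[of 1] integrable_scaled_gauss_on_slice(2)[of t t]
      by (intro integral_mono) (auto split: split_indicator)
    then show "slice_gauss_mass t \<le> t ^ (DIM('a) - 1) * exp (- t\<^sup>2 / 2) * ?M"
      using emeasure_cone_slice_finite[of 1] by (simp add: mult.commute)
  qed
  show "((\<lambda>t. t ^ (DIM('a) - 1) * exp (- t\<^sup>2 / 2) * ?M) \<longlongrightarrow> 0) at_top"
    by (intro tendsto_mult_left_zero tendsto_power_mult_exp_neg_square)
qed simp

end

context cone_slicing
begin

lemma cone_caps_with_equal_gauss_surface_measure:
  assumes "2 \<le> DIM('a)"
  obtains s t where "0 < s" "s < t"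
    "\<And>\<eta>. \<eta> \<subseteq> Omega C \<Longrightarrow>
      gauss_surface_measure (cone_cap C u s) \<eta> = gauss_surface_measure (cone_cap C u t) \<eta>"
proof (cases "measure_space (UNIV::'a set) (sets borel) (hausdorff_outer (real DIM('a) - 1))")
  case True
  interpret cone_slicing_hausdorff C u
    using True by (simp add: cone_slicing_hausdorff_def cone_slicing_hausdorff_axioms_def cone_slicing_axioms)
  obtain s t where "0 < s" "s < t" "slice_gauss_mass s = slice_gauss_mass t"
    using not_injective_if_vanishing_at_0_and_at_top[OF continuous_on_slice_gauss_mass
        slice_gauss_mass_0[OF assms] slice_gauss_mass_nonneg tendsto_slice_gauss_mass] by blast
  then show ?thesis using that gauss_surface_measure_cone_cap by simp
next
  case False
  then show ?thesis using that[of 1 2] gauss_surface_measure_degenerate[OF False] by simp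
qed

end

theorem theorem5p6:
  fixes C \<omega> :: "'a::euclidean_space set"
  assumes "DIM('a) \<ge> 2"
    and "closed C" and "convex C" and "cone C" and "pointed_cone C"
    and "aff_dim C = int DIM('a)"
    and "\<omega> \<subseteq> Omega C" and "\<omega> \<noteq> {}" and "compact \<omega>"
  shows "\<exists>K L. K \<in> KCw C \<omega> \<and> L \<in> KCw C \<omega> \<and> K \<noteq> L \<and>
           (\<forall>\<eta> \<in> sets borel. \<eta> \<subseteq> Omega C \<longrightarrow>
              gauss_surface_measure K \<eta> = gauss_surface_measure L \<eta>)"
proof -
  obtain u where u: "u \<in> \<omega>" using assms(8) by blast
  interpret cone_slicing C u using assms u by unfold_locales auto
  obtain s t where st: "0 < s" "s < t" and same:
    "\<And>\<eta>. \<eta> \<subseteq> Omega C \<Longrightarrow>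
      gauss_surface_measure (cone_cap C u s) \<eta> = gauss_surface_measure (cone_cap C u t) \<eta>"
    using cone_caps_with_equal_gauss_surface_measure assms(1) by blast
  have "cone_cap C u s \<in> KCw C \<omega>" "cone_cap C u t \<in> KCw C \<omega>"
    using st u assms(7) by (auto intro: cone_cap_in_KCw)
  moreover have "cone_cap C u s \<noteq> cone_cap C u t" using st by (rule cone_cap_strict_anti)
  ultimately show ?thesis using same by blast
qed

end
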